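(* Let $(V,H,V')$ be a normal triple of Hilbert spaces and let $\mathbf A:V\to V'$ be a bounded linear operator such that the deterministic equation $\mathbf AU=F$ is uniquely solvable: for every $F\in V'$ there exists a unique solution $U=\mathbf A^{-1}F\in V$, and $\|U\|_V\le C_A\|F\|_{V'}$. Let each $\mathbf M_k$, $k\ge1$, be a bounded linear operator from $V$ to $V'$ so that, for all $v\in V$, $$\|\mathbf A^{-1}\mathbf M_kv\|_V\le C_k\|v\|_V,$$ with $C_k$ independent of $v$. Let $f\in\bar{\mathcal R}L_2(\mathbb F;V')$ for some operator $\bar{\mathcal R}$ (i.e. for some system of positive uniformly bounded weights). Then there exist an operator $\mathcal R$ (i.e. a system of positive uniformly bounded weights $\{r_\alpha\}$) and a unique solution $u\in\mathcal RL_2(\mathbb F;V)$ of $$\mathbf Au+\sum_{k\ge1}(\mathbf M_ku)\diamond\xi_k=f.$$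
   Context: Wiener chaos. $\mathbb F=(\Omega,\mathcal F,\mathbb P)$ is a complete probability space, $\mathcal U$ a real separable Hilbert space with orthonormal basis $\{\mathfrak u_k\}_{k\ge1}$, $\dot W=\{\dot W(h),h\in\mathcal U\}$ a zero-mean Gaussian family with $\mathbb E(\dot W(h_1)\dot W(h_2))=(h_1,h_2)_{\mathcal U}$, and $\mathcal F$ is generated by $\dot W$. Put $\xi_k=\dot W(\mathfrak u_k)$. $\mathcal J$ is the set of multi-indices $\alpha=(\alpha_1,\alpha_2,\dots)$ of non-negative integers with $|\alpha|=\sum_k\alpha_k<\infty$; $\varepsilon_k$ has $1$ in position $k$ and $0$ elsewhere. $\xi_\alpha=\prod_k H_{\alpha_k}(\xi_k)/\sqrt{\alpha_k!}$, $H_n(x)=(-1)^ne^{x^2/2}\frac{d^n}{dx^n}e^{-x^2/2}$; these form an orthonormal basis of $L_2(\mathbb F)$. Weighted spaces. For positive weights $\{r_\alpha\}_{\alpha\in\mathcal J}$ (identified with the operator $\mathcal R\xi_\alpha=r_\alpha\xi_\alpha$) and a Hilbert space $X$, $\mathcal R L_2(\mathbb F;X)$ is the space of formal series $v=\sum_{\alpha}v_\alpha\xi_\alpha$, $v_\alpha\in X$, with $\sum_\alpha r_\alpha^2\|v_\alpha\|_X^2<\infty$. Normal triple: dense continuous embeddings $V\hookrightarrow H\hookrightarrow V'$, $V'$ is the dual of $V$ relative to the inner product of $H$, and $|(h,v)_H|\le C\|v\|_V\|h\|_{V'}$ for $v\in V,h\in H$. Solution: $u=\sum_\alpha u_\alpha\xi_\alpha\in\mathcal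 RL_2(\mathbb F;V)$ is a solution if, for every $\alpha\in\mathcal J$, $$\mathbf Au_\alpha+\sum_{k\ge1}\sqrt{\alpha_k}\,\mathbf M_ku_{\alpha-\varepsilon_k}=f_\alpha\quad\text{in }V'$$ (terms with $\alpha_k=0$ are zero). *)

theory Defs
  imports "HOL-Probability.Probability" "HOL-Library.Poly_Mapping"
begin

text \<open>
  Coordinates \<open>k \<ge> 1\<close> are indexed from \<open>0\<close>: the index \<open>k :: nat\<close> stands for the \<open>(k + 1)\<close>-st
  basis vector, operator, etc. Finitely supported functions are exactly the multi-indices
  with finite \<open>|\<alpha>|\<close>; \<open>\<epsilon>\<^sub>k\<close> is \<open>Poly_Mapping.single k 1\<close>.
\<close>

type_synonym multi_index = "nat \<Rightarrow>\<^sub>0 nat"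

text \<open>A centered Gaussian variable may be degenerate, that is, almost surely \<open>0\<close>.\<close>

definition centered_gaussian :: "'o measure \<Rightarrow> ('o \<Rightarrow> real) \<Rightarrow> bool" where
  "centered_gaussian P X \<longleftrightarrow>
     X \<in> borel_measurable P \<and>
     ((\<exists>\<sigma>>0. distributed P lborel X (normal_density 0 \<sigma>)) \<or> (AE \<omega> in P. X \<omega> = 0))"

text \<open>
  \<open>generated\<close> is the usual reading of ``generated by the noise'' on a complete space,
  i.e. up to null sets.
\<close>

locale wiener_chaos = prob_space P + complete_measure P
  for P :: "'o measure" +
  fixes W :: "'u::{real_inner, polish_space} \<Rightarrow> 'o \<Rightarrow> real"
    and \<uu> :: "nat \<Rightarrow> 'u"
  assumes orthonormal: "\<And>i j. \<uu> i \<bullet> \<uu> j = (if i = j then 1 else 0)"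
    and total: "closure (span (range \<uu>)) = UNIV"
    and gaussian: "\<And>S c. finite S \<Longrightarrow> centered_gaussian P (\<lambda>\<omega>. \<Sum>h\<in>S. c h * W h \<omega>)"
    and covariance: "\<And>h\<^sub>1 h\<^sub>2. expectation (\<lambda>\<omega>. W h\<^sub>1 \<omega> * W h\<^sub>2 \<omega>) = h\<^sub>1 \<bullet> h\<^sub>2"
    and generated: "sets P =
      sigma_sets (space P) ({W h -` B \<inter> space P | h B. B \<in> sets borel} \<union> null_sets P)"
begin

definition \<xi> :: "nat \<Rightarrow> 'o \<Rightarrow> real" where
  "\<xi> k = W (\<uu> k)"

definition hermite :: "nat \<Rightarrow> real \<Rightarrow> real" where
  "hermite n x = (-1) ^ n * exp (x\<^sup>2 / 2) * (deriv ^^ n) (\<lambda>t. exp (- (t\<^sup>2) / 2)) x"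

definition \<xi>_basis :: "multi_index \<Rightarrow> 'o \<Rightarrow> real" where
  "\<xi>_basis \<alpha> \<omega> = (\<Prod>k\<in>Poly_Mapping.keys \<alpha>.
     hermite (Poly_Mapping.lookup \<alpha> k) (\<xi> k \<omega>) / sqrt (fact (Poly_Mapping.lookup \<alpha> k)))"

end

text \<open>
  A formal series \<open>\<Sum>\<^sub>\<alpha> v\<^sub>\<alpha> \<xi>\<^sub>\<alpha>\<close> over the system \<open>\<xi>_basis\<close> need not converge in any space of
  random elements; it is given by its coefficient family.
\<close>

type_synonym 'x chaos_series = "multi_index \<Rightarrow> 'x"

definition bounded_weights :: "(multi_index \<Rightarrow> real) \<Rightarrow> bool" where
  "bounded_weights r \<longleftrightarrow> (\<forall>\<alpha>. 0 < r \<alpha>) \<and> (\<exists>K. \<forall>\<alpha>. r \<alpha> \<le> K)"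

definition weighted_L2 :: "(multi_index \<Rightarrow> real) \<Rightarrow> 'x::real_inner chaos_series set" where
  "weighted_L2 r = {v. (\<lambda>\<alpha>. (r \<alpha>)\<^sup>2 * (norm (v \<alpha>))\<^sup>2) summable_on UNIV}"

text \<open>
  The three spaces are types and the inclusions \<open>V \<subseteq> H \<subseteq> V'\<close> are the injections \<open>\<iota>\<close>, \<open>\<kappa>\<close>.
  \<open>dual\<close>: the form \<open>(h, v) \<mapsto> (h, v)\<^sub>H\<close> extends to a continuous pairing of \<open>V'\<close> with \<open>V\<close> which
  identifies \<open>V'\<close> with the space of all continuous linear functionals on \<open>V\<close> (as a topological
  isomorphism; the norm of \<open>V'\<close> need not be the dual norm).
\<close>

locale normal_triple =
  fixes \<iota> :: "'v::{real_inner, complete_space} \<Rightarrow>\<^sub>L 'h::{real_inner, complete_space}"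
    and \<kappa> :: "'h \<Rightarrow>\<^sub>L 'w::{real_inner, complete_space}"
  assumes inj_V: "inj (blinfun_apply \<iota>)"
    and dense_V: "closure (range (blinfun_apply \<iota>)) = UNIV"
    and inj_H: "inj (blinfun_apply \<kappa>)"
    and dense_H: "closure (range (blinfun_apply \<kappa>)) = UNIV"
    and dual: "\<exists>B :: 'w \<Rightarrow> 'v \<Rightarrow> real. bounded_bilinear B \<and>
      (\<forall>h v. B (blinfun_apply \<kappa> h) v = h \<bullet> blinfun_apply \<iota> v) \<and>
      bij_betw B UNIV {\<phi>. bounded_linear \<phi>}"
    and pairing_bound: "\<exists>C. \<forall>v h.
      \<bar>h \<bullet> blinfun_apply \<iota> v\<bar> \<le> C * norm v * norm (blinfun_apply \<kappa> h)"

text \<open>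
  Coefficient form of \<open>A u + \<Sum>\<^sub>k (M\<^sub>k u) \<diamond> \<xi>\<^sub>k = f\<close>. The sum over \<open>k\<close> ranges over the support of
  \<open>\<alpha>\<close>, since the terms with \<open>\<alpha>\<^sub>k = 0\<close> are zero.
\<close>

definition is_chaos_solution ::
  "('v::real_inner \<Rightarrow>\<^sub>L 'w::real_inner) \<Rightarrow> (nat \<Rightarrow> 'v \<Rightarrow>\<^sub>L 'w) \<Rightarrow> 'w chaos_series \<Rightarrow>
    'v chaos_series \<Rightarrow> bool" where
  "is_chaos_solution A M f u \<longleftrightarrow> (\<forall>\<alpha>.
     blinfun_apply A (u \<alpha>) +
       (\<Sum>k\<in>Poly_Mapping.keys \<alpha>. sqrt (real (Poly_Mapping.lookup \<alpha> k)) *\<^sub>R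
          blinfun_apply (M k) (u (\<alpha> - Poly_Mapping.single k 1))) = f \<alpha>)"

end

theory Submission
  imports Defs
begin

text \<open>
  The equation for \<open>u\<^sub>\<alpha>\<close> involves only \<open>u\<^sub>\<beta>\<close> with \<open>|\<beta>| = |\<alpha>| - 1\<close>, so invertibility of \<open>A\<close> determines
  the whole coefficient family by recursion on \<open>|\<alpha>|\<close>. As there are only
  countably many multi-indices, weights decaying fast enough, of order \<open>2 ^ - n / (1 + \<parallel>u\<^sub>\<alpha>\<parallel>)\<close> at the
  \<open>n\<close>-th multi-index \<open>\<alpha>\<close>, place this family in the weighted space.
\<close>

definition total_degree :: "multi_index \<Rightarrow> nat" where
  "total_degree \<alpha> = (\<Sum>k\<in>Poly_Mapping.keys \<alpha>. Poly_Mapping.lookup \<alpha> k)"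

text \<open>Truncated subtraction does no harm: an entry in the support is at least 1, so it really
  drops by one. As \<open>k\<close> may leave the support, both degrees are summed over the keys of
  \<alpha>.\<close>

lemma total_degree_minus_single_less:
  assumes "k \<in> Poly_Mapping.keys \<alpha>"
  shows "total_degree (\<alpha> - Poly_Mapping.single k 1) < total_degree \<alpha>"
proof -
  let ?\<beta> = "\<alpha> - Poly_Mapping.single k 1"
  have "Poly_Mapping.keys ?\<beta> \<subseteq> Poly_Mapping.keys \<alpha>"
    by (auto simp: in_keys_iff lookup_minus)
  then have "total_degree ?\<beta> = (\<Sum>j\<in>Poly_Mapping.keys \<alpha>. Poly_Mapping.lookup ?\<beta> j)"
    unfolding total_degree_def by (intro sum.mono_neutral_left) (auto simp: in_keys_iff)
  also have "\<dots> < total_degree \<alpha>"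
    unfolding total_degree_def using assms
    by (intro sum_strict_mono_ex1 bexI[of _ k]) (auto simp: in_keys_iff lookup_minus)
  finally show ?thesis .
qed

text \<open>A multi-index is encoded by its graph over its support, a finite subset of a countable
  set of pairs.\<close>

lemma countable_multi_index: "countable (UNIV :: multi_index set)"
proof -
  let ?graph = "\<lambda>\<alpha> :: multi_index. (\<lambda>k. (k, Poly_Mapping.lookup \<alpha> k)) ` Poly_Mapping.keys \<alpha>"
  have "inj ?graph"
  proof (rule injI)
    fix \<alpha> \<beta> :: multi_index
    assume eq: "?graph \<alpha> = ?graph \<beta>"
    \<comment> \<open>Zero entries leave no pair, so a missing \<open>k\<close> encodes the value
      0.\<close>
    have mem: "(k, n) \<in> ?graph \<gamma> \<longleftrightarrow> n = Poly_Mapping.lookup \<gamma> k \<and> n \<noteq> 0" for k n \<gamma>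
      by (auto simp: in_keys_iff)
    have "Poly_Mapping.lookup \<alpha> k = Poly_Mapping.lookup \<beta> k" for k
      using mem[of k _ \<alpha>] mem[of k _ \<beta>] unfolding eq by metis
    then show "\<alpha> = \<beta>" by (rule poly_mapping_eqI)
  qed
  moreover have "countable (range ?graph)"
    by (rule countable_subset[OF _ countable_Collect_finite]) auto
  ultimately show ?thesis
    using countable_image_inj_on by blast
qed

text \<open>The coefficient equation solved for its leading term. The recursion terminates for every
  \<open>A\<close>; \<open>inv\<close> is a true inverse once \<open>A\<close> is bijective.\<close>

function chaos_solution ::
  "('v::real_inner \<Rightarrow>\<^sub>L 'w::real_inner) \<Rightarrow> (nat \<Rightarrow> 'v \<Rightarrow>\<^sub>L 'w) \<Rightarrow> 'w chaos_series \<Rightarrow> 'v chaos_series" where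
  "chaos_solution A M f \<alpha> = inv (blinfun_apply A) (f \<alpha> -
     (\<Sum>k\<in>Poly_Mapping.keys \<alpha>. sqrt (real (Poly_Mapping.lookup \<alpha> k)) *\<^sub>R
        blinfun_apply (M k) (chaos_solution A M f (\<alpha> - Poly_Mapping.single k 1))))"
  by auto
termination
  by (relation "Wellfounded.measure (\<lambda>(A, M, f, \<alpha>). total_degree \<alpha>)")
    (use total_degree_minus_single_less in auto)

declare chaos_solution.simps [simp del]

text \<open>Existence and uniqueness are settled here among all formal series, before any weights
  enter.\<close>

lemma is_chaos_solution_iff:
  assumes "bij (blinfun_apply A)"
  shows "is_chaos_solution A M f u \<longleftrightarrow> u = chaos_solution A M f"
proof
  assume u: "is_chaos_solution A M f u"
  have "u \<alpha> = chaos_solution A M f \<alpha>" for \<alpha>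
  proof (induction \<alpha> rule: measure_induct_rule[of total_degree])
    case (less \<alpha>)
    have "blinfun_apply A (u \<alpha>) = f \<alpha> -
        (\<Sum>k\<in>Poly_Mapping.keys \<alpha>. sqrt (real (Poly_Mapping.lookup \<alpha> k)) *\<^sub>R
          blinfun_apply (M k) (u (\<alpha> - Poly_Mapping.single k 1)))"
      using u unfolding is_chaos_solution_def by (simp add: eq_diff_eq)
    also have "\<dots> = f \<alpha> -
        (\<Sum>k\<in>Poly_Mapping.keys \<alpha>. sqrt (real (Poly_Mapping.lookup \<alpha> k)) *\<^sub>R
          blinfun_apply (M k) (chaos_solution A M f (\<alpha> - Poly_Mapping.single k 1)))"
      by (intro arg_cong2[where f = minus] refl sum.cong)
        (simp only: less total_degree_minus_single_less)
    finally show ?case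
      unfolding chaos_solution.simps[of A M f \<alpha>]
      by (metis assms bij_is_inj inv_f_f)
  qed
  then show "u = chaos_solution A M f" by (rule ext)
next
  assume u: "u = chaos_solution A M f"
  show "is_chaos_solution A M f u"
    unfolding is_chaos_solution_def u
    by (subst chaos_solution.simps) (simp add: surj_f_inv_f[OF bij_is_surj[OF assms]])
qed

text \<open>Each coefficient is damped by its own weight, so arbitrarily fast growth of the norms is
  allowed.\<close>

lemma exists_bounded_weights_weighted_L2:
  fixes v :: "'x::real_inner chaos_series"
  shows "\<exists>r. bounded_weights r \<and> v \<in> weighted_L2 r"
proof -
  let ?n = "to_nat_on (UNIV :: multi_index set)"
  \<comment> \<open>The power of 1/2 gives summability along the enumeration. The denominator
    absorbs the norm of \<open>v \<alpha>\<close>; its summand 1 keeps it positive and the weights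
    at most 1.\<close>
  define r where "r \<alpha> = (1/2) ^ ?n \<alpha> / (1 + norm (v \<alpha>))" for \<alpha>
  have pos: "0 < r \<alpha>" for \<alpha>
    unfolding r_def by (intro divide_pos_pos add_pos_nonneg) auto
  have le: "r \<alpha> \<le> 1" for \<alpha>
  proof -
    have "(1/2 :: real) ^ ?n \<alpha> \<le> 1" by (rule power_le_one) auto
    then have "(1/2 :: real) ^ ?n \<alpha> \<le> 1 + norm (v \<alpha>)"
      by (smt (verit) norm_ge_zero)
    then show ?thesis unfolding r_def by (simp add: divide_le_eq add_pos_nonneg)
  qed
  have bound: "(r \<alpha>)\<^sup>2 * (norm (v \<alpha>))\<^sup>2 \<le> (1/4) ^ ?n \<alpha>" for \<alpha>
  proof -
    have "r \<alpha> * norm (v \<alpha>) = (1/2) ^ ?n \<alpha> * (norm (v \<alpha>) / (1 + norm (v \<alpha>)))"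
      unfolding r_def by simp
    also have "\<dots> \<le> (1/2) ^ ?n \<alpha> * 1"
      by (intro mult_left_mono) (auto simp: divide_le_eq add_pos_nonneg)
    finally have "(r \<alpha> * norm (v \<alpha>))\<^sup>2 \<le> ((1/2) ^ ?n \<alpha>)\<^sup>2"
      using pos[of \<alpha>] by (intro power_mono) auto
    also have "\<dots> = (1/4) ^ ?n \<alpha>"
      by (simp add: power2_eq_square flip: power_mult_distrib)
    finally show ?thesis by (simp add: power_mult_distrib)
  qed
  have "(\<lambda>n. (1/4 :: real) ^ n) summable_on UNIV"
    by (rule norm_summable_imp_summable_on) (simp add: summable_geometric norm_power)
  \<comment> \<open>By injectivity of \<open>?n\<close>, the series over multi-indices is a
    geometric series restricted to the range of \<open>?n\<close>.\<close>
  then have "(\<lambda>n. (1/4 :: real) ^ n) summable_on range ?n"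
    by (rule summable_on_subset_banach) simp
  then have "(\<lambda>\<alpha>. (1/4 :: real) ^ ?n \<alpha>) summable_on UNIV"
    by (subst (asm) summable_on_reindex)
      (auto simp: inj_on_to_nat_on countable_multi_index o_def)
  then have "v \<in> weighted_L2 r"
    unfolding weighted_L2_def mem_Collect_eq
    by (rule summable_on_comparison_test) (use bound in auto)
  moreover have "bounded_weights r"
    unfolding bounded_weights_def using pos le by blast
  ultimately show ?thesis by blast
qed

theorem theorem3:
  fixes P :: "'o measure"
    and W :: "'u::{real_inner, polish_space} \<Rightarrow> 'o \<Rightarrow> real"
    and \<uu> :: "nat \<Rightarrow> 'u"
    and \<iota> :: "'v::{real_inner, complete_space} \<Rightarrow>\<^sub>L 'h::{real_inner, complete_space}"
    and \<kappa> :: "'h \<Rightarrow>\<^sub>L 'w::{real_inner, complete_space}"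
    and A :: "'v \<Rightarrow>\<^sub>L 'w"
    and M :: "nat \<Rightarrow> 'v \<Rightarrow>\<^sub>L 'w"
    and C\<^sub>A :: real
    and C :: "nat \<Rightarrow> real"
    and r_bar :: "multi_index \<Rightarrow> real"
    and f :: "'w chaos_series"
  assumes "wiener_chaos P W \<uu>"
    and "normal_triple \<iota> \<kappa>"
    and "\<forall>F. \<exists>!U. blinfun_apply A U = F"
    and "\<forall>F. norm (inv (blinfun_apply A) F) \<le> C\<^sub>A * norm F"
    and "\<forall>k v. norm (inv (blinfun_apply A) (blinfun_apply (M k) v)) \<le> C k * norm v"
    and "bounded_weights r_bar"
    and "f \<in> weighted_L2 r_bar"
  shows "\<exists>r. bounded_weights r \<and> (\<exists>!u. u \<in> weighted_L2 r \<and> is_chaos_solution A M f u)"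
proof -
  have "bij (blinfun_apply A)"
    using assms(3) by (simp add: bij_iff)
  \<comment> \<open>The weights are fitted to the only possible solution, so uniqueness in the
    weighted space is inherited.\<close>
  then show ?thesis
    using exists_bounded_weights_weighted_L2[of "chaos_solution A M f"]
    by (auto simp: is_chaos_solution_iff)
qed

end
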